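(* Let $G \ne K_4$ be a connected, claw-free, cubic graph of order $n$. Then $F(G) \le \frac{1}{2}n$, with equality if and only if $G$ is the diamond-necklace $N_2$ or the prism $C_3 \,\Box\, K_2$.
   Context: Graphs are finite and simple. A graph is claw-free if it contains no induced $K_{1,3}$. Forcing process: given $S \subseteq V(G)$ of initially colored vertices, at each step, if a colored vertex has exactly one non-colored neighbor, that neighbor becomes colored. $S$ is a forcing set (zero forcing set) if iterating this process colors all of $V(G)$; $F(G)$ is the minimum size of a forcing set. A diamond is $K_4$ minus an edge. The diamond-necklace $N_2$ is obtained from two disjoint diamonds $D_1, D_2$ with $V(D_i)=\{a_i,b_i,c_i,d_i\}$ and $a_ib_i$ the missing edge of $D_i$, by adding the edges $a_1b_2$ and $a_2b_1$. The prism $C_3 \,\Box\, K_2$ is the Cartesian product of a triangle and an edge. *)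

theory Defs
  imports "Graph_Theory.Graph_Theory"
begin

text \<open>
  A finite simple graph is a \<^locale>\<open>pair_graph\<close>: a finite, loop-free digraph without
  parallel arcs whose arc relation is symmetric, each edge being the pair of opposite arcs. The
  coercion \<^const>\<open>with_proj\<close> is inserted implicitly where a \<^typ>\<open>('a, 'b) pre_digraph\<close>
  is expected.
\<close>

definition claw_free :: "('a, 'b) pre_digraph \<Rightarrow> bool" where
  "claw_free G \<longleftrightarrow> \<not> (\<exists>H. induced_subgraph H G \<and> complete_bipartite_digraph 1 3 H)"

text \<open>As arcs come in opposite pairs, the out-degree is the degree.\<close>

definition cubic :: "('a, 'b) pre_digraph \<Rightarrow> bool" where
  "cubic G \<longleftrightarrow> (\<forall>v \<in> verts G. out_degree G v = 3)"

definition neighbors :: "'a pair_pre_digraph \<Rightarrow> 'a \<Rightarrow> 'a set" where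
  "neighbors G u = {v. (u, v) \<in> parcs G}"

definition force_step :: "'a pair_pre_digraph \<Rightarrow> 'a set \<Rightarrow> 'a set" where
  "force_step G C = C \<union> {w. \<exists>u \<in> C. neighbors G u - C = {w}}"

definition forcing_set :: "'a pair_pre_digraph \<Rightarrow> 'a set \<Rightarrow> bool" where
  "forcing_set G S \<longleftrightarrow> S \<subseteq> pverts G \<and> (\<exists>k. (force_step G ^^ k) S = pverts G)"

text \<open>The minimum exists for every finite graph, since the whole vertex set is forcing.\<close>

definition forcing_number :: "'a pair_pre_digraph \<Rightarrow> nat" where
  "forcing_number G = (LEAST k. \<exists>S. forcing_set G S \<and> card S = k)"

definition complete_graph :: "nat \<Rightarrow> nat pair_pre_digraph" where
  "complete_graph n = \<lparr> pverts = {..<n}, parcs = {(i, j). i < n \<and> j < n \<and> i \<noteq> j} \<rparr>"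

text \<open>A simple graph only for \<open>n \<ge> 3\<close>.\<close>

definition cycle_graph :: "nat \<Rightarrow> nat pair_pre_digraph" where
  "cycle_graph n = \<lparr> pverts = {..<n}, parcs = symcl {(i, Suc i mod n) | i. i < n} \<rparr>"

definition cartesian_product ::
  "'a pair_pre_digraph \<Rightarrow> 'b pair_pre_digraph \<Rightarrow> ('a \<times> 'b) pair_pre_digraph" where
  "cartesian_product G H = \<lparr> pverts = pverts G \<times> pverts H,
     parcs = {((u, x), (v, y)) | u x v y.
       (u = v \<and> u \<in> pverts G \<and> (x, y) \<in> parcs H) \<or>
       (x = y \<and> x \<in> pverts H \<and> (u, v) \<in> parcs G)} \<rparr>"

definition prism :: "(nat \<times> nat) pair_pre_digraph" where
  "prism = cartesian_product (cycle_graph 3) (complete_graph 2)"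

datatype diamond_vertex = DA | DB | DC | DD

text \<open>The missing edge of the diamond is the one between \<open>DA\<close> and \<open>DB\<close>.\<close>

definition diamond :: "diamond_vertex pair_pre_digraph" where
  "diamond = \<lparr> pverts = UNIV, parcs = {(x, y). x \<noteq> y} - {(DA, DB), (DB, DA)} \<rparr>"

definition diamond_necklace_2 :: "(nat \<times> diamond_vertex) pair_pre_digraph" where
  "diamond_necklace_2 = \<lparr> pverts = {1, 2} \<times> pverts diamond,
     parcs = {((i, x), (i, y)) | i x y. i \<in> {1, 2} \<and> (x, y) \<in> parcs diamond}
       \<union> symcl {((1, DA), (2, DB)), ((2, DA), (1, DB))} \<rparr>"

end

theory Submission
  imports Defs
begin

text \<open>
  A forcing process is extended greedily. If the coloured set is closed under forcing but is not
  everything, connectedness gives a coloured vertex with exactly two uncoloured neighbours; colouring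
  one of them forces the other, so each further initial vertex yields at least two coloured ones.
  Hence \<open>2F \<le> n - k\<close> as soon as some initial set \<open>S\<close> forces \<open>2|S| + k\<close> vertices. In a claw-free cubic
  graph other than \<open>K\<^sub>4\<close> every vertex lies in a triangle, and either some triangle is in no diamond or
  all are. A triangle in no diamond forces its three outer neighbours, and three vertices of a diamond
  force the fourth and the two outer neighbours, so three initial vertices give six. Looking at the triangles through the outer neighbours, one finds a set
  gaining one more vertex, unless the outer neighbours close up to the prism or to \<open>N\<^sub>2\<close>.

  Conversely, the first vertex to force has two neighbours in \<open>S\<close>, so \<open>|S| \<ge> 3\<close>, and in \<open>N\<^sub>2\<close> each of
  the two pairs of twins must meet \<open>S\<close>, which no three vertices of a closed neighbourhood can achieve.
\<close>

section \<open>Zero forcing\<close>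

text \<open>The rule asks only that the neighbours other than \<open>w\<close> be coloured, so it is
  monotone in \<open>S\<close> and independent of the order of the forces. Upper bounds can then be
  shown force by force, without counting the parallel rounds of \<open>force_step\<close>.\<close>

inductive_set forced :: "'a pair_pre_digraph \<Rightarrow> 'a set \<Rightarrow> 'a set" for G S where
  initial: "v \<in> S \<Longrightarrow> v \<in> forced G S"
| force: "u \<in> forced G S \<Longrightarrow> w \<in> neighbors G u \<Longrightarrow>
    (\<forall>v \<in> neighbors G u - {w}. v \<in> forced G S) \<Longrightarrow> w \<in> forced G S"

lemma forced_mono: "S \<subseteq> T \<Longrightarrow> forced G S \<subseteq> forced G T"
proof
  fix v assume "S \<subseteq> T" "v \<in> forced G S"
  from this(2) show "v \<in> forced G T"
    by induction (use \<open>S \<subseteq> T\<close> in \<open>auto intro: forced.intros\<close>)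
qed

lemma (in pair_wf_digraph) neighbors_subset: "neighbors G u \<subseteq> pverts G"
  by (auto simp: neighbors_def in_arcsD2)

lemma (in pair_wf_digraph) forced_subset: "S \<subseteq> pverts G \<Longrightarrow> forced G S \<subseteq> pverts G"
proof
  fix v assume "S \<subseteq> pverts G" "v \<in> forced G S"
  from this(2) show "v \<in> pverts G"
    by induction (use \<open>S \<subseteq> pverts G\<close> neighbors_subset in auto)
qed

lemma subset_force_step: "C \<subseteq> force_step G C"
  by (auto simp: force_step_def)

lemma (in pair_wf_digraph) force_step_subset: "C \<subseteq> pverts G \<Longrightarrow> force_step G C \<subseteq> pverts G"
  using neighbors_subset by (auto simp: force_step_def)

lemma (in pair_wf_digraph) force_step_pow_subset:
  "C \<subseteq> pverts G \<Longrightarrow> (force_step G ^^ k) C \<subseteq> pverts G"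
  by (induction k) (auto dest: force_step_subset)

lemma subset_force_step_pow: "C \<subseteq> (force_step G ^^ k) C"
  by (induction k) (use subset_force_step in fastforce)+

lemma forced_subset_closed:
  assumes "S \<subseteq> C" "force_step G C = C"
  shows "forced G S \<subseteq> C"
proof
  fix v assume "v \<in> forced G S"
  then show "v \<in> C"
  proof induction
    case (force u w)
    then have "w \<in> C \<or> neighbors G u - C = {w}" by auto
    then have "w \<in> force_step G C"
      using force.IH(1) unfolding force_step_def by blast
    then show ?case using assms(2) by simp
  qed (use assms in auto)
qed

text \<open>The iterates of \<open>force_step\<close> grow inside a finite set, so one of maximal
  size is a fixed point. A fixed point is closed under the inductive rule and hence contains
  \<open>forced G S\<close>.\<close>

lemma (in pair_fin_digraph) forcing_setI:
  assumes S: "S \<subseteq> pverts G" and V: "pverts G \<subseteq> forced G S"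
  shows "forcing_set G S"
proof -
  let ?it = "\<lambda>k. (force_step G ^^ k) S"
  have sub: "?it k \<subseteq> pverts G" for k by (rule force_step_pow_subset[OF S])
  have "card (?it k) < Suc (card (pverts G))" for k
    using card_mono[OF pair_finite_verts sub] by (simp only: less_Suc_eq_le)
  then have "\<exists>k. True \<and> (\<forall>j. True \<longrightarrow> card (?it j) \<le> card (?it k))"
    by (intro ex_has_greatest_nat[where k = 0]) auto
  then obtain k where k: "card (?it j) \<le> card (?it k)" for j by auto
  have "?it k = ?it (Suc k)"
  proof (rule card_seteq)
    show "finite (?it (Suc k))" using finite_subset[OF sub pair_finite_verts] .
    show "?it k \<subseteq> ?it (Suc k)" using subset_force_step by (simp only: funpow.simps o_apply)
  qed (rule k)
  from this[symmetric] have "forced G S \<subseteq> ?it k"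
    by (intro forced_subset_closed subset_force_step_pow) simp
  with V have "?it k = pverts G" using sub by blast
  with S show ?thesis unfolding forcing_set_def by (intro conjI exI[of _ k])
qed

lemma forcing_number_le: "forcing_set G S \<Longrightarrow> forcing_number G \<le> card S"
  unfolding forcing_number_def by (rule Least_le) blast

lemma forcing_number_attained:
  obtains S where "forcing_set G S" "card S = forcing_number G"
proof -
  have "forcing_set G (pverts G)"
    unfolding forcing_set_def by (intro conjI exI[of _ 0]) simp_all
  then have "\<exists>k S. forcing_set G S \<and> card S = k" by blast
  from LeastI_ex[OF this] have "\<exists>S. forcing_set G S \<and> card S = forcing_number G"
    by (simp only: forcing_number_def)
  then show ?thesis using that by blast
qed

text \<open>If no vertex of \<open>C\<close> had exactly one neighbour outside \<open>C\<close>, no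
  round could leave \<open>C\<close>. Taking \<open>C = S\<close> gives the first force; taking a
  complement shows that forts are hit.\<close>

lemma forcing_set_not_closed:
  assumes "forcing_set G S" "S \<subseteq> C" "C \<subset> pverts G"
  obtains u w where "u \<in> C" "neighbors G u - C = {w}"
proof -
  obtain k where k: "(force_step G ^^ k) S = pverts G"
    using assms(1) by (auto simp: forcing_set_def)
  have "\<exists>u \<in> C. \<exists>w. neighbors G u - C = {w}"
  proof (rule ccontr)
    assume no: "\<not> ?thesis"
    have "(force_step G ^^ j) S \<subseteq> C" for j
    proof (induction j)
      case (Suc j)
      show ?case
      proof
        fix w assume "w \<in> (force_step G ^^ Suc j) S"
        then have "w \<in> force_step G ((force_step G ^^ j) S)" by simp
        then consider "w \<in> C" |
          u where "u \<in> C" "neighbors G u - (force_step G ^^ j) S = {w}"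
          using Suc unfolding force_step_def by blast
        then show "w \<in> C"
        proof cases
          case 2
          \<comment> \<open>Passing from the iterate to the larger set \<open>C\<close> only removes
            uncoloured neighbours of \<open>u\<close>; if \<open>w\<close> survived,
            \<open>u\<close> would contradict \<open>no\<close>.\<close>
          then have "neighbors G u - C \<subseteq> {w}" using Suc by auto
          moreover have "w \<in> neighbors G u" using 2 by auto
          ultimately show ?thesis using no 2 by blast
        qed
      qed
    qed (use assms in simp)
    from this[of k] k assms(3) show False by auto
  qed
  then show ?thesis using that by blast
qed

lemma forcing_set_initial_step:
  assumes "forcing_set G S" "S \<noteq> pverts G"
  obtains u w where "u \<in> S" "neighbors G u - S = {w}"
  using forcing_set_not_closed[of G S S] assms by (auto simp: forcing_set_def)

text \<open>The vertex making the first force is coloured together with two of its three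
  neighbours.\<close>

lemma forcing_set_cubic:
  assumes "forcing_set G S" "S \<noteq> pverts G" "finite (pverts G)"
    and card: "\<And>u. u \<in> S \<Longrightarrow> card (neighbors G u) = 3" and irr: "\<And>u. u \<notin> neighbors G u"
  obtains u where "u \<in> S" "card (insert u (neighbors G u) \<inter> S) = 3"
proof -
  obtain u w where u: "u \<in> S" "neighbors G u - S = {w}"
    using forcing_set_initial_step assms(1,2) by metis
  have "insert u (neighbors G u) \<inter> S = insert u (neighbors G u - {w})" using u by auto
  moreover have "w \<in> neighbors G u" using u by auto
  ultimately have "card (insert u (neighbors G u) \<inter> S) = 3"
    using card[OF u(1)] irr[of u] card_ge_0_finite[of "neighbors G u"] by simp
  with u that show ?thesis by blast
qed

text \<open>\<open>T\<close> is a fort: no vertex outside it has exactly one neighbour in it, so a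
  process started in the complement of \<open>T\<close> never enters \<open>T\<close>.\<close>

lemma (in pair_wf_digraph) forcing_set_meets_fort:
  assumes "forcing_set G S" "T \<subseteq> pverts G" "T \<noteq> {}"
    and fort: "\<And>u w. u \<in> pverts G - T \<Longrightarrow> neighbors G u \<inter> T \<noteq> {w}"
  shows "S \<inter> T \<noteq> {}"
proof
  assume "S \<inter> T = {}"
  then have "S \<subseteq> pverts G - T" using assms(1) by (auto simp: forcing_set_def)
  moreover have "pverts G - T \<subset> pverts G" using assms(2,3) by blast
  ultimately obtain u w where u: "u \<in> pverts G - T" "neighbors G u - (pverts G - T) = {w}"
    by (rule forcing_set_not_closed[OF assms(1)])
  moreover have "neighbors G u - (pverts G - T) = neighbors G u \<inter> T"
    using neighbors_subset assms(2) by blast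
  ultimately show False using fort by simp
qed

section \<open>Isomorphisms\<close>

text \<open>In pair graphs an arc is determined by its ends, so a vertex bijection preserving
  neighbourhoods extends to the arcs as \<open>map_prod f f\<close>.\<close>

lemma (in pair_wf_digraph) digraph_isoI:
  fixes H :: "'b pair_pre_digraph"
  assumes inj: "inj_on f (pverts G)" and img: "f ` pverts G = pverts H"
    and nb: "\<And>u. u \<in> pverts G \<Longrightarrow> neighbors H (f u) = f ` neighbors G u"
    and wf: "pair_wf_digraph H"
  shows "digraph_iso G H"
proof -
  interpret H: pair_wf_digraph H by fact
  let ?h = "\<lparr>iso_verts = f, iso_arcs = map_prod f f, iso_head = snd, iso_tail = fst\<rparr>"
  have sub: "parcs G \<subseteq> pverts G \<times> pverts G"
    using in_arcsD1 in_arcsD2 by auto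
  have "digraph_isomorphism ?h"
    unfolding digraph_isomorphism_def
    using inj wf_digraph_axioms map_prod_inj_on[OF inj inj] sub
    by (auto intro: inj_on_subset)
  moreover have "map_prod f f ` parcs G = parcs H"
  proof (intro equalityI subsetI)
    fix e assume "e \<in> map_prod f f ` parcs G"
    then obtain u v where "e = (f u, f v)" "(u, v) \<in> parcs G" by auto
    with nb[of u] show "e \<in> parcs H" using in_arcsD1 by (auto simp: neighbors_def)
  next
    fix e assume e: "e \<in> parcs H"
    obtain u' v' where [simp]: "e = (u', v')" by fastforce
    obtain u where u: "u \<in> pverts G" "u' = f u"
      using e H.in_arcsD1[of u' v'] img by auto
    then have "v' \<in> f ` neighbors G u" using e nb[OF u(1)] by (auto simp: neighbors_def)
    with u show "e \<in> map_prod f f ` parcs G" by (auto simp: neighbors_def)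
  qed
  ultimately show ?thesis
    unfolding digraph_iso_def
    by (intro exI[of _ ?h]) (auto simp: with_proj_def app_iso_def img)
qed

lemma (in pair_wf_digraph) digraph_isoE:
  fixes H :: "'b pair_pre_digraph"
  assumes "digraph_iso G H"
  obtains f where "inj_on f (pverts G)" "f ` pverts G = pverts H"
    "\<forall>u \<in> pverts G. neighbors H (f u) = f ` neighbors G u"
proof -
  obtain h where h: "digraph_isomorphism h" and H: "with_proj H = app_iso h G"
    using assms by (auto simp: digraph_iso_def)
  let ?f = "iso_verts h"
  have V: "pverts H = ?f ` pverts G" and E: "parcs H = iso_arcs h ` parcs G"
    and t: "iso_tail h = fst" "iso_head h = snd"
    using arg_cong[OF H, of verts] arg_cong[OF H, of arcs] arg_cong[OF H, of tail]
      arg_cong[OF H, of head] by auto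
  have inj: "inj_on ?f (pverts G)" using h by (auto simp: digraph_isomorphism_def)
  have arc: "iso_arcs h e = (?f (fst e), ?f (snd e))" if "e \<in> parcs G" for e
    using h that t by (auto simp: digraph_isomorphism_def prod_eq_iff)
  have E: "parcs H = (\<lambda>e. (?f (fst e), ?f (snd e))) ` parcs G"
    unfolding E using arc by (rule image_cong[OF refl])
  have "neighbors H (?f u) = ?f ` neighbors G u" if "u \<in> pverts G" for u
  proof -
    have "(?f u, w) \<in> parcs H \<longleftrightarrow> (\<exists>v. (u, v) \<in> parcs G \<and> w = ?f v)" for w
    proof
      assume "(?f u, w) \<in> parcs H"
      then obtain a b where ab: "(a, b) \<in> parcs G" "?f u = ?f a" "w = ?f b"
        unfolding E by auto
      then have "u = a" using inj_onD[OF inj _ that] in_arcsD1 by metis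
      with ab show "\<exists>v. (u, v) \<in> parcs G \<and> w = ?f v" by blast
    qed (force simp: E)
    then show ?thesis by (auto simp: neighbors_def)
  qed
  with inj V that show ?thesis by auto
qed

text \<open>An isomorphism commutes with \<open>force_step\<close>, so it maps forcing sets to
  forcing sets. With \<open>H\<close> the prism or the necklace, this carries their lower bounds
  over to \<open>G\<close>.\<close>

lemma forcing_number_le_iso:
  assumes "pair_wf_digraph G" "digraph_iso (with_proj G) (with_proj H)"
  shows "forcing_number H \<le> forcing_number G"
proof -
  interpret pair_wf_digraph G by fact
  from assms(2) obtain f where f: "inj_on f (pverts G)" "f ` pverts G = pverts H"
    and nb: "\<forall>u \<in> pverts G. neighbors H (f u) = f ` neighbors G u"
    by (rule digraph_isoE)
  obtain S where S: "forcing_set G S" "card S = forcing_number G"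
    by (rule forcing_number_attained)
  then obtain k where SV: "S \<subseteq> pverts G" and k: "(force_step G ^^ k) S = pverts G"
    by (auto simp: forcing_set_def)
  have step: "force_step H (f ` C) = f ` force_step G C" if C: "C \<subseteq> pverts G" for C
  proof -
    have *: "neighbors H (f u) - f ` C = f ` (neighbors G u - C)" if "u \<in> C" for u
    proof -
      have "neighbors H (f u) = f ` neighbors G u" using nb that C by auto
      moreover have "f ` (neighbors G u - C) = f ` neighbors G u - f ` C"
        using neighbors_subset[of u] C by (intro inj_on_image_set_diff[OF f(1)]) auto
      ultimately show ?thesis by simp
    qed
    have "f ` (neighbors G u - C) = {w} \<longleftrightarrow> (\<exists>v. w = f v \<and> neighbors G u - C = {v})"
      if "u \<in> C" for u w
    proof -
      have inj: "inj_on f (neighbors G u - C)"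
        using f(1) neighbors_subset by (meson Diff_subset inj_on_subset subset_trans)
      show ?thesis
      proof
        assume w: "f ` (neighbors G u - C) = {w}"
        then obtain v where v: "v \<in> neighbors G u - C" "w = f v" by blast
        have "v' = v" if "v' \<in> neighbors G u - C" for v'
          using inj_onD[OF inj _ that v(1)] that v(2) w by blast
        with v show "\<exists>v. w = f v \<and> neighbors G u - C = {v}" by blast
      qed (metis image_empty image_insert)
    qed
    with * have "{w. \<exists>u\<in>C. neighbors H (f u) - f ` C = {w}} =
        {w. \<exists>u\<in>C. \<exists>v. w = f v \<and> neighbors G u - C = {v}}"
      by (simp cong: bex_cong)
    also have "\<dots> = f ` {v. \<exists>u\<in>C. neighbors G u - C = {v}}" by blast
    finally show ?thesis by (simp add: force_step_def image_Un)
  qed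
  have "(force_step H ^^ j) (f ` S) = f ` (force_step G ^^ j) S" for j
    by (induction j) (simp_all add: step force_step_pow_subset SV)
  then have "forcing_set H (f ` S)"
    unfolding forcing_set_def using k f(2) image_mono[OF SV, of f] by (intro conjI exI[of _ k]) simp_all
  then have "forcing_number H \<le> card (f ` S)" by (rule forcing_number_le)
  also have "\<dots> = forcing_number G"
    using S(2) card_image[OF inj_on_subset[OF f(1) SV]] by simp
  finally show ?thesis .
qed

section \<open>Connected claw-free cubic graphs\<close>

locale claw_free_cubic_graph = pair_graph +
  assumes not_K4: "\<not> complete_digraph 4 G"
    and connected: "Digraph_Component.connected G"
    and claw_free: "claw_free G"
    and cubic: "cubic G"
begin

abbreviation "N \<equiv> neighbors G"
abbreviation "V \<equiv> pverts G"

lemma N_sym: "v \<in> N u \<Longrightarrow> u \<in> N v"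
  using arcs_symmetric by (auto simp: neighbors_def)

lemma N_irrefl: "u \<notin> N u"
  using no_loops' by (auto simp: neighbors_def)

lemma N_verts: "v \<in> N u \<Longrightarrow> u \<in> V" "v \<in> N u \<Longrightarrow> v \<in> V"
  using wellformed' by (auto simp: neighbors_def)

lemma finite_N: "finite (N u)"
  using neighbors_subset pair_finite_verts by (rule finite_subset)

lemma card_N: "u \<in> V \<Longrightarrow> card (N u) = 3"
proof -
  assume "u \<in> V"
  have "out_arcs G u = Pair u ` N u" by (auto simp: out_arcs_def neighbors_def)
  then have "out_degree G u = card (N u)"
    by (simp add: out_degree_def card_image inj_on_def)
  with \<open>u \<in> V\<close> cubic show ?thesis by (simp add: cubic_def)
qed

lemma N_eqI:
  assumes "b \<in> N a" "c \<in> N a" "d \<in> N a" "distinct [b, c, d]"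
  shows "N a = {b, c, d}"
proof -
  have "card {b, c, d} = card (N a)" using assms card_N N_verts(1) by simp
  then show ?thesis using assms finite_N by (metis card_subset_eq empty_subsetI insert_subset)
qed

lemma third_neighbor:
  assumes "b \<in> N a" "c \<in> N a" "b \<noteq> c"
  obtains d where "N a = {b, c, d}" "d \<noteq> b" "d \<noteq> c"
proof -
  have "card (N a - {b, c}) = 1"
    using assms card_N[OF N_verts(1)[OF assms(1)]] by (simp add: card_Diff_subset)
  then obtain d where "N a - {b, c} = {d}" by (auto simp: card_1_singleton_iff)
  with assms that[of d] show ?thesis by blast
qed

lemma triangle_at:
  assumes "u \<in> V"
  obtains p q where "p \<in> N u" "q \<in> N u" "q \<in> N p"
proof -
  obtain p q r where N: "N u = {p, q, r}" 
    using card_N[OF assms] by (auto simp: card_3_iff)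
  have "q \<in> N p \<or> r \<in> N p \<or> r \<in> N q"
  proof (rule ccontr)
    assume no: "\<not> ?thesis"
    define P where "P = N u"
    \<comment> \<open>If the three neighbours of \<open>u\<close> were pairwise nonadjacent, this
      star would be an induced claw.\<close>
    define H where "H = \<lparr>pverts = insert u P, parcs = {u} \<times> P \<union> P \<times> {u}\<rparr>"
    have V: "insert u P \<subseteq> V" using assms neighbors_subset[of u] by (auto simp: P_def)
    have nu: "u \<notin> P" using N_irrefl by (simp add: P_def)
    have un: "(u, v) \<in> parcs G \<longleftrightarrow> v \<in> P" "(v, u) \<in> parcs G \<longleftrightarrow> v \<in> P" for v
      using arcs_symmetric by (auto simp: neighbors_def P_def)
    have indep: "(v, w) \<notin> parcs G" if "v \<in> P" "w \<in> P" for v w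
    proof -
      have "w \<notin> N v" using no that N_sym N_irrefl unfolding P_def N by blast
      then show ?thesis by (simp add: neighbors_def)
    qed
    have arcs: "parcs H = {e \<in> parcs G. fst e \<in> pverts H \<and> snd e \<in> pverts H}"
      unfolding H_def using un indep nu by auto
    have "pair_wf_digraph H" by unfold_locales (auto simp: H_def)
    then have "wf_digraph (with_proj H)" by (simp add: wf_digraph_wp_iff)
    then have "induced_subgraph (with_proj H) (with_proj G)"
      using arcs V wf_digraph_axioms
      by (auto simp: induced_subgraph_def subgraph_def compatible_def H_def)
    moreover have "complete_bipartite_digraph 1 3 (with_proj H)"
      unfolding complete_bipartite_digraph_pair_def
    proof (intro conjI exI)
      show "pverts H = {u} \<union> P" "parcs H = {u} \<times> P \<union> P \<times> {u}"
        by (simp_all add: H_def)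
      show "card P = 3" using card_N[OF assms] by (simp add: P_def)
      show "finite (pverts H)" using finite_N by (simp add: H_def P_def)
    qed (use nu in auto)
    ultimately show False using claw_free unfolding claw_free_def by blast
  qed
  with N that show ?thesis by blast
qed

lemma closed_eq_verts:
  assumes "u \<in> C" "C \<subseteq> V" and cl: "\<And>u. u \<in> C \<Longrightarrow> N u \<subseteq> C"
  shows "C = V"
proof
  show "V \<subseteq> C"
  proof
    fix v assume "v \<in> V"
    with assms connected have "(u, v) \<in> rtrancl_on V (symcl (parcs G))"
      unfolding connected_conv by auto
    then show "v \<in> C"
    proof (induction rule: rtrancl_on_induct)
      case (step y z)
      from step(2) have "z \<in> N y"
        using arcs_symmetric by (auto simp: symcl_def neighbors_def)
      with step cl show ?case by blast
    qed (use assms in simp)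
  qed
qed fact

section \<open>Greedy extension of a forcing process\<close>

text \<open>Induction on the number of unforced vertices: each added vertex raises
  \<open>card (forced G S)\<close> by at least two. The third assumption gives every initial vertex
  a coloured neighbour, so that no vertex on the boundary has three uncoloured ones.\<close>

lemma greedy_extension:
  assumes "S \<subseteq> V" "S \<noteq> {}" and "\<forall>s \<in> S. \<exists>t \<in> forced G S. t \<in> N s"
  shows "2 * forcing_number G + card (forced G S) \<le> 2 * card S + card V"
  using assms
proof (induction "card (V - forced G S)" arbitrary: S rule: less_induct)
  case less
  let ?F = "forced G S"
  have FV: "?F \<subseteq> V" using forced_subset less.prems(1) .
  have finS: "finite S" using less.prems(1) pair_finite_verts finite_subset by blast
  show ?case
  proof (cases "?F = V")
    case True
    then have "forcing_set G S" using less.prems(1) by (intro forcing_setI) auto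
    then show ?thesis using True forcing_number_le[of G S] by auto
  next
    case False
    from less.prems(2) obtain s where "s \<in> ?F" using forced.initial by fast
    then have "\<exists>u \<in> ?F. \<not> N u \<subseteq> ?F"
      using closed_eq_verts[of s ?F] False FV by metis
    then obtain u w where u: "u \<in> ?F" and w: "w \<in> N u" "w \<notin> ?F" by blast
    \<comment> \<open>An initial vertex has a coloured neighbour by assumption, a forced one has the
      vertex that forced it.\<close>
    have "\<exists>t \<in> ?F. t \<in> N u"
      using u
    proof cases
      case initial
      then show ?thesis using less.prems(3) by blast
    next
      case (force u')
      then show ?thesis using N_sym by blast
    qed
    then obtain t where t: "t \<in> ?F" "t \<in> N u" by blast
    with w have "t \<noteq> w" by auto
    from third_neighbor[OF t(2) w(1) this]
    obtain w' where Nu: "N u = {t, w, w'}" and w': "w' \<noteq> t" "w' \<noteq> w" by metis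
    \<comment> \<open>Were \<open>w'\<close> coloured, \<open>u\<close> would already have forced
      \<open>w\<close>.\<close>
    have w'F: "w' \<notin> ?F"
    proof
      assume "w' \<in> ?F"
      then have "\<forall>v \<in> N u - {w}. v \<in> ?F" using t(1) Nu by auto
      from forced.force[OF u w(1) this] w(2) show False by blast
    qed
    let ?S = "insert w S"
    have FF: "?F \<subseteq> forced G ?S" by (rule forced_mono) auto
    have wF: "w \<in> forced G ?S" by (rule forced.initial) simp
    have "w' \<in> forced G ?S"
      by (rule forced.force[of u]) (use FF u t(1) wF Nu in auto)
    with FF wF have sub: "insert w (insert w' ?F) \<subseteq> forced G ?S" by blast
    have SV: "?S \<subseteq> V" using less.prems(1) w N_verts(2) by blast
    have finF: "finite (forced G ?S)"
      using forced_subset[OF SV] pair_finite_verts by (rule finite_subset)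
    have "w \<notin> S" using w(2) forced.initial by metis
    have "card ?F + 2 \<le> card (forced G ?S)"
      using card_mono[OF finF sub] w(2) w'F w'(2) finite_subset[OF FF finF] by simp
    moreover have "card (V - forced G ?S) < card (V - ?F)"
      using sub w N_verts(2) pair_finite_verts by (intro psubset_card_mono) auto
    then have "2 * forcing_number G + card (forced G ?S) \<le> 2 * card ?S + card V"
    proof (rule less.hyps)
      show "\<forall>s \<in> ?S. \<exists>t \<in> forced G ?S. t \<in> N s"
        using less.prems(3) FF u N_sym[OF w(1)] by blast
    qed (use SV in auto)
    ultimately show ?thesis using \<open>w \<notin> S\<close> finS by simp
  qed
qed

text \<open>The form used for explicit configurations: \<open>xs\<close> is the start,
  \<open>ys\<close> lists distinct forced vertices, and \<open>k\<close> is the surplus over two per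
  initial vertex. \<open>k = 0\<close> gives the bound, \<open>k = 1\<close> makes it
  strict.\<close>

lemma forcing_number_bound:
  assumes "set xs \<subseteq> V" "xs \<noteq> []" "\<forall>s \<in> set xs. \<exists>t \<in> forced G (set xs). t \<in> N s"
    and "set ys \<subseteq> forced G (set xs)" "distinct ys" "2 * length xs + k \<le> length ys"
  shows "2 * forcing_number G + k \<le> card V"
proof -
  have "finite (forced G (set xs))"
    using forced_subset[OF assms(1)] pair_finite_verts by (rule finite_subset)
  then have "length ys \<le> card (forced G (set xs))"
    using card_mono[OF _ assms(4)] distinct_card[OF assms(5)] by simp
  then show ?thesis
    using greedy_extension[of "set xs"] assms(1-3,6) card_length[of xs] by simp
qed

lemma forced_third:
  assumes "u \<in> forced G S" "N u = {p, q, r}" "p \<in> forced G S" "q \<in> forced G S"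
  shows "r \<in> forced G S"
  by (rule forced.force[of u]) (use assms in auto)

end

section \<open>The prism and the diamond-necklace\<close>

lemma parcs_cycle_graph_3: "parcs (cycle_graph 3) = {(0,1),(1,2),(2,0),(1,0),(2,1),(0,2)}"
proof -
  have "{(i, Suc i mod 3) | i. i < 3} = (\<lambda>i. (i, Suc i mod 3)) ` {..<3}" by auto
  also have "\<dots> = {(0,1),(1,2),(2,0)}" by (simp add: lessThan_nat_numeral lessThan_Suc insert_commute numeral_2_eq_2)
  finally show ?thesis by (auto simp: cycle_graph_def symcl_def)
qed

lemma pverts_prism: "pverts prism = {(0,0),(1,0),(2,0),(0,1),(1,1),(2,1)}"
  by (auto simp: prism_def cartesian_product_def cycle_graph_def complete_graph_def)

lemma parcs_prism:
  "((i, j), (k, l)) \<in> parcs prism \<longleftrightarrow>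
    (i = k \<and> i < 3 \<and> j < 2 \<and> l < 2 \<and> j \<noteq> l) \<or>
    (j = l \<and> j < 2 \<and> (i, k) \<in> {(0,1),(1,2),(2,0),(1,0),(2,1),(0,2)})"
  unfolding prism_def cartesian_product_def parcs_cycle_graph_3
  by (auto simp: cycle_graph_def complete_graph_def)

lemma neighbors_prism:
  "neighbors prism (0,0) = {(1,0),(2,0),(0,1)}"
  "neighbors prism (1,0) = {(0,0),(2,0),(1,1)}"
  "neighbors prism (2,0) = {(0,0),(1,0),(2,1)}"
  "neighbors prism (0,1) = {(0,0),(1,1),(2,1)}"
  "neighbors prism (1,1) = {(1,0),(0,1),(2,1)}"
  "neighbors prism (2,1) = {(2,0),(0,1),(1,1)}"
  by (auto simp: neighbors_def parcs_prism)

lemma pair_wf_prism: "pair_wf_digraph prism"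
  by unfold_locales (auto simp: parcs_prism pverts_prism)

lemma all_diamond_vertex: "(\<forall>x. P x) \<longleftrightarrow> P DA \<and> P DB \<and> P DC \<and> P DD"
  by (metis diamond_vertex.exhaust)

lemma pverts_necklace: "pverts diamond_necklace_2 =
    {(1,DA),(1,DB),(1,DC),(1,DD),(2,DA),(2,DB),(2,DC),(2,DD)}"
  by (auto simp: diamond_necklace_2_def diamond_def set_eq_iff all_diamond_vertex)

lemma parcs_necklace:
  "((i, x), (j, y)) \<in> parcs diamond_necklace_2 \<longleftrightarrow>
    (i = j \<and> (i = 1 \<or> i = 2) \<and> x \<noteq> y \<and> (x, y) \<noteq> (DA, DB) \<and> (x, y) \<noteq> (DB, DA)) \<or>
    (i = 1 \<and> j = 2 \<or> i = 2 \<and> j = 1) \<and> ((x, y) = (DA, DB) \<or> (x, y) = (DB, DA))"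
  by (auto simp: diamond_necklace_2_def diamond_def symcl_def)

lemma neighbors_necklace:
  "neighbors diamond_necklace_2 (1,DA) = {(1,DC),(1,DD),(2,DB)}"
  "neighbors diamond_necklace_2 (1,DB) = {(1,DC),(1,DD),(2,DA)}"
  "neighbors diamond_necklace_2 (1,DC) = {(1,DA),(1,DB),(1,DD)}"
  "neighbors diamond_necklace_2 (1,DD) = {(1,DA),(1,DB),(1,DC)}"
  "neighbors diamond_necklace_2 (2,DA) = {(2,DC),(2,DD),(1,DB)}"
  "neighbors diamond_necklace_2 (2,DB) = {(2,DC),(2,DD),(1,DA)}"
  "neighbors diamond_necklace_2 (2,DC) = {(2,DA),(2,DB),(2,DD)}"
  "neighbors diamond_necklace_2 (2,DD) = {(2,DA),(2,DB),(2,DC)}"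
  unfolding neighbors_def set_eq_iff split_paired_All all_diamond_vertex
  by (auto simp: parcs_necklace)

lemma pair_wf_necklace: "pair_wf_digraph diamond_necklace_2"
  by unfold_locales (auto simp: diamond_necklace_2_def diamond_def symcl_def)

section \<open>Lower bounds for the two extremal graphs\<close>

lemma forcing_number_prism: "3 \<le> forcing_number prism"
proof -
  obtain S where S: "forcing_set prism S" "card S = forcing_number prism"
    by (rule forcing_number_attained)
  have SV: "S \<subseteq> pverts prism" using S(1) by (simp add: forcing_set_def)
  have fV: "finite (pverts prism)" by (simp add: pverts_prism)
  have fin: "finite S" using SV fV by (rule finite_subset)
  show ?thesis
  proof (cases "S = pverts prism")
    case True
    then show ?thesis using S(2) by (simp add: pverts_prism)
  next
    case False
    have card3: "card (neighbors prism u) = 3" if "u \<in> pverts prism" for u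
      using that by (auto simp: pverts_prism neighbors_prism simp del: One_nat_def)
    have irr: "u \<notin> neighbors prism u" for u
      by (cases u) (auto simp: neighbors_def parcs_prism)
    obtain u where "card (insert u (neighbors prism u) \<inter> S) = 3"
      using forcing_set_cubic[OF S(1) False fV card3 irr] SV by blast
    then show ?thesis using S(2) fin card_mono[of S "insert u (neighbors prism u) \<inter> S"] by simp
  qed
qed

text \<open>The vertices \<open>DC\<close> and \<open>DD\<close> of a diamond are twins, so no vertex outside the pair can force
  only one of them.\<close>

lemma forcing_set_necklace:
  assumes "forcing_set diamond_necklace_2 S" "i = 1 \<or> i = 2"
  shows "S \<inter> {(i, DC), (i, DD)} \<noteq> {}"
proof (rule pair_wf_digraph.forcing_set_meets_fort[OF pair_wf_necklace assms(1)])
  show "{(i, DC), (i, DD)} \<subseteq> pverts diamond_necklace_2"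
    using assms(2) by (auto simp: pverts_necklace)
  show "neighbors diamond_necklace_2 u \<inter> {(i, DC), (i, DD)} \<noteq> {w}"
    if "u \<in> pverts diamond_necklace_2 - {(i, DC), (i, DD)}" for u w
  proof
    let ?N = "neighbors diamond_necklace_2 u" and ?T = "{(i, DC), (i, DD)}"
    assume eq: "?N \<inter> ?T = {w}"
    then have "w \<in> ?N \<inter> ?T" by simp
    moreover have "(i, DC) \<in> ?N \<longleftrightarrow> (i, DD) \<in> ?N"
      using that assms(2) by (auto simp: pverts_necklace neighbors_necklace simp del: One_nat_def)
    ultimately have "?T \<subseteq> ?N" by auto
    then have "?T \<subseteq> {w}" using eq by (simp only: Int_absorb1)
    then show False by auto
  qed
qed simp

lemma forcing_number_necklace: "4 \<le> forcing_number diamond_necklace_2"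
proof -
  let ?G = diamond_necklace_2
  obtain S where S: "forcing_set ?G S" "card S = forcing_number ?G"
    by (rule forcing_number_attained)
  have SV: "S \<subseteq> pverts ?G" using S(1) by (simp add: forcing_set_def)
  have fV: "finite (pverts ?G)" by (simp add: pverts_necklace)
  have fin: "finite S" using SV fV by (rule finite_subset)
  show ?thesis
  proof (cases "S = pverts ?G")
    case True
    then show ?thesis using S(2) by (simp add: pverts_necklace)
  next
    case False
    have card3: "card (neighbors ?G u) = 3" if "u \<in> pverts ?G" for u
      using that by (auto simp: pverts_necklace neighbors_necklace simp del: One_nat_def)
    have irr: "u \<notin> neighbors ?G u" for u
      by (cases u) (auto simp: neighbors_def parcs_necklace)
    obtain u where u: "u \<in> S" "card (insert u (neighbors ?G u) \<inter> S) = 3"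
      using forcing_set_cubic[OF S(1) False fV card3 irr] SV by blast
    \<comment> \<open>Edges between the diamonds join ends \<open>DA\<close> and \<open>DB\<close>
      only, so a closed neighbourhood misses the twins of one diamond. There \<open>S\<close> needs
      a vertex besides the three.\<close>
    have "insert u (neighbors ?G u) \<inter> {(1, DC), (1, DD)} = {} \<or>
        insert u (neighbors ?G u) \<inter> {(2, DC), (2, DD)} = {}"
      using subsetD[OF SV u(1)] by (auto simp: pverts_necklace neighbors_necklace simp del: One_nat_def)
    moreover have "S \<inter> {(1, DC), (1, DD)} \<noteq> {}" "S \<inter> {(2, DC), (2, DD)} \<noteq> {}"
      using forcing_set_necklace[OF S(1)] by auto
    ultimately have "insert u (neighbors ?G u) \<inter> S \<subset> S" by blast
    from psubset_card_mono[OF fin this] show ?thesis using u(2) S(2) by simp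
  qed
qed

section \<open>Triangles and diamonds\<close>

context claw_free_cubic_graph
begin

lemma N_eq_verts: "N a = {b, c, d} \<Longrightarrow> {a, b, c, d} \<subseteq> V"
  using N_verts[of b a] neighbors_subset[of a] by simp

text \<open>The four vertices already have degree three among themselves, so they are closed under
  adjacency and by connectedness exhaust \<open>G\<close>.\<close>

lemma no_K4:
  assumes "b \<in> N a" "c \<in> N a" "d \<in> N a" "c \<in> N b" "d \<in> N b" "d \<in> N c"
  shows False
proof -
  have ne: "distinct [a, b, c, d]" using assms N_irrefl by auto
  have N: "N a = {b, c, d}" by (rule N_eqI) (use assms ne in simp_all)
  have N_b: "N b = {a, c, d}" by (rule N_eqI) (use assms N_sym[of b a] ne in simp_all)
  have N_c: "N c = {a, b, d}"
    by (rule N_eqI) (use assms N_sym[of c a] N_sym[of c b] ne in simp_all)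
  have N_d: "N d = {a, b, c}"
    by (rule N_eqI) (use assms N_sym[of d a] N_sym[of d b] N_sym[of d c] ne in simp_all)
  have N_diff: "N u = {a, b, c, d} - {u}" if "u \<in> {a, b, c, d}" for u
  proof -
    have "{b, c, d} = {a, b, c, d} - {a}" "{a, c, d} = {a, b, c, d} - {b}"
      "{a, b, d} = {a, b, c, d} - {c}" "{a, b, c} = {a, b, c, d} - {d}"
      using ne by auto
    with N N_b N_c N_d that show ?thesis by (elim insertE) simp_all
  qed
  have V: "{a, b, c, d} = V"
  proof (rule closed_eq_verts[of a])
    show "N u \<subseteq> {a, b, c, d}" if "u \<in> {a, b, c, d}" for u
      unfolding N_diff[OF that] by blast
  qed (use N_eq_verts[OF N] in simp_all)
  have "(u, v) \<in> parcs G \<longleftrightarrow> u \<in> V \<and> v \<in> V \<and> u \<noteq> v" for u v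
  proof -
    have "v \<in> N u \<longleftrightarrow> u \<in> V \<and> v \<in> V \<and> u \<noteq> v"
      using N_diff[of u] N_verts(1)[of v u] unfolding V by (cases "u \<in> V") auto
    then show ?thesis by (simp add: neighbors_def)
  qed
  then have "parcs G = {(u, v). (u, v) \<in> V \<times> V \<and> u \<noteq> v}" by auto
  moreover have "card V = 4" unfolding V[symmetric] using ne by simp
  ultimately have "complete_digraph 4 G"
    unfolding complete_digraph_pair_def using pair_finite_verts by simp
  with not_K4 show False ..
qed

text \<open>\<open>lone_triangle a b c x y z\<close>: the triangle \<open>abc\<close> lies in no diamond, and \<open>x\<close>, \<open>y\<close>, \<open>z\<close> are the
  outer neighbours of \<open>a\<close>, \<open>b\<close>, \<open>c\<close>. \<open>ends_diamond a b c d x y\<close>: \<open>ab\<close> is the missing edge of the diamond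
  \<open>abcd\<close>, and \<open>x\<close>, \<open>y\<close> are the outer neighbours of \<open>a\<close>, \<open>b\<close>.\<close>

definition "lone_triangle a b c x y z \<longleftrightarrow>
  N a = {b, c, x} \<and> N b = {a, c, y} \<and> N c = {a, b, z} \<and> distinct [a, b, c, x, y, z]"

definition "ends_diamond a b c d x y \<longleftrightarrow>
  N a = {c, d, x} \<and> N b = {c, d, y} \<and> N c = {a, b, d} \<and> N d = {a, b, c} \<and>
  distinct [a, b, c, d, x, y]"

lemma lone_triangle_swap12:
  assumes "lone_triangle a b c x y z"
  shows "lone_triangle b a c y x z"
proof -
  have "N c = {b, a, z}" using assms by (simp add: lone_triangle_def insert_commute)
  moreover have "distinct [b, a, c, y, x, z]" using assms unfolding lone_triangle_def by auto
  ultimately show ?thesis using assms by (simp only: lone_triangle_def)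
qed

lemma lone_triangle_swap23:
  assumes "lone_triangle a b c x y z"
  shows "lone_triangle a c b x z y"
proof -
  have "N a = {c, b, x}" using assms by (simp add: lone_triangle_def insert_commute)
  moreover have "distinct [a, c, b, x, z, y]" using assms unfolding lone_triangle_def by auto
  ultimately show ?thesis using assms by (simp only: lone_triangle_def)
qed

lemma ends_diamond_at:
  assumes Nc: "N c = {a, b, d}" and Nd: "N d = {a, b, c}" and ne: "distinct [a, b, c, d]"
  obtains x y where "ends_diamond a b c d x y"
proof -
  have in_N: "c \<in> N a" "d \<in> N a" "c \<in> N b" "d \<in> N b" "d \<in> N c"
    using Nc Nd N_sym by blast+
  have ab: "b \<notin> N a" using no_K4[of b a c d] in_N by blast
  obtain x where Na: "N a = {c, d, x}" and x: "x \<noteq> c" "x \<noteq> d"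
    using third_neighbor[OF in_N(1,2)] ne by simp metis
  obtain y where Nb: "N b = {c, d, y}" and y: "y \<noteq> c" "y \<noteq> d"
    using third_neighbor[OF in_N(3,4)] ne by simp metis
  have out: "x \<noteq> a" "x \<noteq> b" "y \<noteq> a" "y \<noteq> b"
    using ab N_irrefl[of a] N_irrefl[of b] N_sym[of a b] by (auto simp: Na Nb)
  \<comment> \<open>A common outer neighbour \<open>x\<close> would be adjacent to \<open>a\<close>,
    \<open>b\<close> and some \<open>z\<close>, which are pairwise nonadjacent, so \<open>x\<close>
    would lie in no triangle.\<close>
  have "x \<noteq> y"
  proof
    assume "x = y"
    then have "a \<in> N x" "b \<in> N x" using N_sym[of x a] N_sym[of x b] by (simp_all add: Na Nb)
    then obtain z where Nx: "N x = {a, b, z}" and z: "z \<noteq> a" "z \<noteq> b"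
      using third_neighbor[of a x b] ne by simp metis
    have "x \<in> V" using N_verts(2)[of x a] by (simp add: Na)
    then obtain p q where pq: "p \<in> N x" "q \<in> N x" "q \<in> N p" by (rule triangle_at)
    have "x \<notin> N c" "x \<notin> N d" using out x by (simp_all add: Nc Nd)
    then have "c \<noteq> z" "d \<noteq> z" using N_sym[of z x] by (auto simp: Nx)
    moreover have "x \<noteq> z" using N_irrefl[of x] by (auto simp: Nx)
    ultimately have "z \<notin> N a" "z \<notin> N b" using \<open>x = y\<close> by (auto simp: Na Nb)
    moreover from this have "a \<notin> N b" "a \<notin> N z" "b \<notin> N z" using ab N_sym by blast+
    ultimately show False using pq ab N_irrefl by (auto simp: Nx)
  qed
  then have "ends_diamond a b c d x y"
    unfolding ends_diamond_def using Na Nb Nc Nd ne x y out by simp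
  then show ?thesis by (rule that)
qed

text \<open>Each vertex of the triangle has one further neighbour. If two of these coincide in
  \<open>e\<close>, the edge between their vertices lies in a second triangle. That the third vertex
  is not adjacent to \<open>e\<close> is left to \<open>ends_diamond_at\<close>.\<close>

lemma triangle_or_diamond:
  assumes "p \<in> N u" "q \<in> N u" "q \<in> N p"
  obtains x y z where "lone_triangle u p q x y z"
  | e where "N u = {p, q, e}" "N p = {u, q, e}" "distinct [u, p, q, e]"
  | e where "N u = {p, q, e}" "N q = {u, p, e}" "distinct [u, p, q, e]"
  | e where "N p = {u, q, e}" "N q = {u, p, e}" "distinct [u, p, q, e]"
proof -
  have ne: "u \<noteq> p" "u \<noteq> q" "p \<noteq> q" using assms N_irrefl by metis+
  obtain x where x: "N u = {p, q, x}" "x \<noteq> p" "x \<noteq> q"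
    using third_neighbor[OF assms(1,2)] ne by metis
  obtain y where y: "N p = {u, q, y}" "y \<noteq> u" "y \<noteq> q"
    using third_neighbor[of u p q] assms N_sym ne by metis
  obtain z where z: "N q = {u, p, z}" "z \<noteq> u" "z \<noteq> p"
    using third_neighbor[of u q p] assms N_sym ne by metis
  have "x \<noteq> u" "y \<noteq> p" "z \<noteq> q"
    using N_irrefl[of u] N_irrefl[of p] N_irrefl[of q] by (auto simp: x(1) y(1) z(1))
  note facts = this x y z ne
  show thesis
  proof (cases "distinct [x, y, z]")
    case True
    with facts have "lone_triangle u p q x y z" unfolding lone_triangle_def by simp
    then show thesis by (rule that(1))
  next
    case False
    then consider "y = x" | "z = x" | "z = y" by auto
    then show thesis
      by cases (use facts in \<open>simp_all add: that(2-4)\<close>)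
  qed
qed

section \<open>Recognising the prism and the necklace\<close>

text \<open>The six vertices are closed under adjacency, hence all of \<open>G\<close>. The map
  starts from the prism, whose neighbourhoods are explicit, and the isomorphism is reversed at the
  end.\<close>

lemma prism_iso:
  assumes "lone_triangle a b c x y z" and N: "N x = {a, y, z}" "N y = {b, x, z}" "N z = {c, x, y}"
  shows "digraph_iso G prism"
proof -
  define f where "f = (\<lambda>(i :: nat, j :: nat).
    if j = 0 then (if i = 0 then a else if i = 1 then b else c)
    else (if i = 0 then x else if i = 1 then y else z))"
  have f: "f (0,0) = a" "f (1,0) = b" "f (2,0) = c" "f (0,1) = x" "f (1,1) = y" "f (2,1) = z"
    by (simp_all add: f_def)
  have nb: "N a = {b, c, x}" "N b = {a, c, y}" "N c = {a, b, z}"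
      "N x = {a, y, z}" "N y = {b, x, z}" "N z = {c, x, y}"
    and ne: "distinct [a, b, c, x, y, z]"
    using assms(1) N unfolding lone_triangle_def by simp_all
  have "{a, b, c, x, y, z} = V"
  proof (rule closed_eq_verts[of a])
    show "{a, b, c, x, y, z} \<subseteq> V" using nb[THEN N_eq_verts] by simp
  qed (auto simp: nb)
  have "digraph_iso prism G"
  proof (rule pair_wf_digraph.digraph_isoI[OF pair_wf_prism, where f = f])
    show "inj_on f (pverts prism)"
      using ne by (simp add: pverts_prism f del: One_nat_def)
    show "f ` pverts prism = V"
      unfolding \<open>_ = V\<close>[symmetric] by (simp add: pverts_prism f del: One_nat_def)
    show "N (f u) = f ` neighbors prism u" if "u \<in> pverts prism" for u
      using that by (auto simp: nb pverts_prism neighbors_prism f simp del: One_nat_def)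
    show "pair_wf_digraph G" by unfold_locales
  qed
  then show ?thesis
    using digraph_iso_swap pair_wf_prism wf_digraph_wp_iff by metis
qed

lemma necklace_iso:
  assumes "ends_diamond a b c d x y" and "ends_diamond x y p q a b"
    and ne: "distinct [a, b, c, d, x, y, p, q]"
  shows "digraph_iso G diamond_necklace_2"
proof -
  \<comment> \<open>Necklace edges join \<open>DA\<close> of one diamond to \<open>DB\<close> of the
    other; as \<open>x\<close> is the outer neighbour of \<open>a\<close>, it is the image of
    \<open>(2,DB)\<close> and \<open>y\<close> that of \<open>(2,DA)\<close>.\<close>
  define f where "f = (\<lambda>(i :: nat, t). if i = 1
    then (case t of DA \<Rightarrow> a | DB \<Rightarrow> b | DC \<Rightarrow> c | DD \<Rightarrow> d)
    else (case t of DA \<Rightarrow> y | DB \<Rightarrow> x | DC \<Rightarrow> p | DD \<Rightarrow> q))"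
  have f: "f (1,DA) = a" "f (1,DB) = b" "f (1,DC) = c" "f (1,DD) = d"
    "f (2,DA) = y" "f (2,DB) = x" "f (2,DC) = p" "f (2,DD) = q"
    by (simp_all add: f_def)
  have nb: "N a = {c, d, x}" "N b = {c, d, y}" "N c = {a, b, d}" "N d = {a, b, c}"
    "N x = {p, q, a}" "N y = {p, q, b}" "N p = {x, y, q}" "N q = {x, y, p}"
    using assms(1,2) unfolding ends_diamond_def by simp_all
  have "{a, b, c, d, x, y, p, q} = V"
  proof (rule closed_eq_verts[of a])
    show "{a, b, c, d, x, y, p, q} \<subseteq> V" using nb[THEN N_eq_verts] by simp
  qed (auto simp: nb)
  have "digraph_iso diamond_necklace_2 G"
  proof (rule pair_wf_digraph.digraph_isoI[OF pair_wf_necklace, where f = f])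
    show "inj_on f (pverts diamond_necklace_2)"
      using ne by (auto simp: pverts_necklace f simp del: One_nat_def)
    show "f ` pverts diamond_necklace_2 = V"
      unfolding \<open>_ = V\<close>[symmetric] by (auto simp: pverts_necklace f simp del: One_nat_def)
    show "N (f u) = f ` neighbors diamond_necklace_2 u" if "u \<in> pverts diamond_necklace_2" for u
      using that by (auto simp: nb pverts_necklace neighbors_necklace f simp del: One_nat_def)
    show "pair_wf_digraph G" by unfold_locales
  qed
  then show ?thesis
    using digraph_iso_swap pair_wf_necklace wf_digraph_wp_iff by metis
qed

subsection \<open>Upper bounds\<close>

lemma forced_lone_triangle:
  assumes "lone_triangle a b c x y z" and "a \<in> forced G S" "b \<in> forced G S" "c \<in> forced G S"
  shows "set [a, b, c, x, y, z] \<subseteq> forced G S"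
proof -
  have N: "N a = {b, c, x}" "N b = {a, c, y}" "N c = {a, b, z}"
    using assms(1) by (simp_all add: lone_triangle_def)
  have "x \<in> forced G S" "y \<in> forced G S" "z \<in> forced G S"
    using forced_third[OF assms(2) N(1)] forced_third[OF assms(3) N(2)]
      forced_third[OF assms(4) N(3)] assms(2-4) by simp_all
  with assms(2-4) show ?thesis by simp
qed

lemma forced_ends_diamond:
  assumes "ends_diamond a b c d x y" and "a \<in> forced G S" "c \<in> forced G S" "d \<in> forced G S"
  shows "set [a, b, c, d, x, y] \<subseteq> forced G S"
proof -
  have N: "N a = {c, d, x}" "N b = {c, d, y}" "N c = {a, d, b}"
    using assms(1) by (simp_all add: ends_diamond_def insert_commute)
  have "x \<in> forced G S" "b \<in> forced G S"
    using forced_third[OF assms(2) N(1)] forced_third[OF assms(3) N(3)] assms(2-4) by simp_all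
  moreover from this(2) have "y \<in> forced G S"
    using forced_third[OF _ N(2)] assms(3,4) by simp
  ultimately show ?thesis using assms(2-4) by simp
qed

section \<open>Graphs with a triangle in no diamond\<close>

lemma lone_triangle_verts:
  assumes "lone_triangle a b c x y z"
  shows "set [a, b, c, x, y, z] \<subseteq> V"
proof -
  have N: "N a = {b, c, x}" "N b = {a, c, y}" "N c = {a, b, z}"
    using assms by (simp_all add: lone_triangle_def)
  then show ?thesis using N[THEN N_eq_verts] by simp
qed

lemma lone_triangle_bound:
  assumes t: "lone_triangle a b c x y z"
  shows "2 * forcing_number G \<le> card V"
    and "w \<in> forced G {a, b, c} \<Longrightarrow> w \<notin> {a, b, c, x, y, z} \<Longrightarrow> 2 * forcing_number G + 1 \<le> card V"
proof -
  have N: "N a = {b, c, x}" "N b = {a, c, y}" "N c = {a, b, z}"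
    and ne: "distinct [a, b, c, x, y, z]"
    using t by (simp_all add: lone_triangle_def)
  have abc: "a \<in> forced G {a, b, c}" "b \<in> forced G {a, b, c}" "c \<in> forced G {a, b, c}"
    by (simp_all add: forced.initial)
  note F = forced_lone_triangle[OF t this]
  have S: "set [a, b, c] \<subseteq> V" "[a, b, c] \<noteq> []"
    using lone_triangle_verts[OF t] by simp_all
  have nb: "\<forall>s \<in> set [a, b, c]. \<exists>t \<in> forced G (set [a, b, c]). t \<in> N s"
    using abc by (auto simp: N)
  show "2 * forcing_number G \<le> card V"
    using forcing_number_bound[OF S nb, of "[a, b, c, x, y, z]" 0] F ne by simp
  show "2 * forcing_number G + 1 \<le> card V"
    if "w \<in> forced G {a, b, c}" "w \<notin> {a, b, c, x, y, z}"
    using forcing_number_bound[OF S nb, of "[w, a, b, c, x, y, z]" 1] F ne that by simp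
qed

text \<open>\<open>a\<close> and \<open>x\<close> have no common neighbour, so the triangle at
  \<open>x\<close> consists of \<open>x\<close>, \<open>y\<close> and the third neighbour
  \<open>w\<close> of \<open>x\<close>. Either \<open>w = z\<close> and the graph closes up to the
  prism, or \<open>w\<close> is a seventh vertex, forced by \<open>x\<close>.\<close>

lemma lone_triangle_adjacent:
  assumes t: "lone_triangle a b c x y z" and xy: "y \<in> N x"
  shows "2 * forcing_number G + 1 \<le> card V \<or> digraph_iso G prism"
proof -
  have N: "N a = {b, c, x}" "N b = {a, c, y}" "N c = {a, b, z}"
    and ne: "distinct [a, b, c, x, y, z]"
    using t by (simp_all add: lone_triangle_def)
  have adj: "a \<in> N x" "b \<in> N y" "c \<in> N z" "x \<in> N y"
    using N_sym[of x a] N_sym[of y b] N_sym[of z c] N_sym[OF xy] N by simp_all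
  obtain w where Nx: "N x = {a, y, w}" and w: "w \<noteq> a" "w \<noteq> y"
    using third_neighbor[OF adj(1) xy] ne by simp metis
  have out: "a \<notin> N y" "y \<notin> N a" "w \<noteq> x" "w \<notin> N a" "w \<notin> N b" "w \<noteq> b" "w \<noteq> c"
  proof -
    show "y \<notin> N a" using ne by (auto simp: N)
    then show "a \<notin> N y" using N_sym by blast
    show "w \<noteq> x" using N_irrefl[of x] by (auto simp: Nx)
    show "w \<noteq> b" "w \<noteq> c" using N_sym[of w x] ne by (auto simp: Nx N)
    then show "w \<notin> N a" "w \<notin> N b" using w \<open>w \<noteq> x\<close> by (auto simp: N)
  qed
  obtain p q where "p \<in> N x" "q \<in> N x" "q \<in> N p"
    using triangle_at N_verts(1)[OF xy] by metis
  then have "w \<in> N y"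
    using out N_sym[of a w] N_sym[of y w] N_irrefl by (auto simp: Nx)
  then have Ny: "N y = {b, x, w}"
    using adj out ne by (intro N_eqI) auto
  have wF: "w \<in> forced G {a, b, c}"
    using forced_third[of x _ a y w] Nx forced_lone_triangle[OF t, of "{a, b, c}"]
    by (simp add: forced.initial)
  show ?thesis
  proof (cases "w = z")
    case True
    have "N z = {c, x, y}"
      using adj N_sym[of w x] N_sym[of w y] True ne by (intro N_eqI) (auto simp: Nx Ny)
    then show ?thesis using prism_iso[OF t] Nx Ny True by simp
  next
    case False
    then have "w \<notin> {a, b, c, x, y, z}" using out w by simp
    with wF show ?thesis using lone_triangle_bound(2)[OF t] by blast
  qed
qed

text \<open>A triangle at \<open>y\<close> would contain \<open>b\<close> or \<open>p\<close>, since
  \<open>y\<close> has only one other neighbour. But the other neighbours of \<open>b\<close> are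
  \<open>a\<close>, \<open>c\<close>, those of \<open>p\<close> are \<open>x\<close>,
  \<open>q\<close>, and none of these is adjacent to \<open>y\<close>.\<close>

lemma lone_triangle_split:
  assumes t: "lone_triangle a b c x y z" and xy: "y \<notin> N x"
    and Np: "N p = {x, q, y}" and Nq: "N q = {x, p, z}" and out: "p \<notin> {a, b, c, x, y, z}"
  shows False
proof -
  have N: "N a = {b, c, x}" "N b = {a, c, y}" "N c = {a, b, z}"
    and ne: "distinct [a, b, c, x, y, z]"
    using t by (simp_all add: lone_triangle_def)
  have y: "b \<in> N y" "p \<in> N y" using N_sym[of y b] N_sym[of y p] by (simp_all add: N Np)
  obtain u where Ny: "N y = {b, p, u}" and u: "u \<noteq> b" "u \<noteq> p"
    using third_neighbor[OF y] out by simp metis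
  have "y \<notin> N a" "y \<notin> N c" "y \<notin> N q" using ne out by (auto simp: N Nq)
  moreover have "y \<in> N u" using N_sym[of u y] by (simp add: Ny)
  ultimately have "u \<notin> {a, c, x, q}" "u \<noteq> y" using xy N_irrefl[of y] by auto
  then have *: "u \<notin> N b" "u \<notin> N p" "p \<notin> N b" using out by (auto simp: N Np)
  then have "b \<notin> N u" "p \<notin> N u" "b \<notin> N p" using N_sym by blast+
  moreover obtain r s where "r \<in> N y" "s \<in> N y" "s \<in> N r"
    using triangle_at N_verts(1)[OF y(1)] by metis
  ultimately show False using * N_irrefl by (auto simp: Ny)
qed

text \<open>Here \<open>x\<close> and \<open>y\<close> are the ends of a diamond, and the process
  starts there rather than at the triangle: \<open>x\<close> forces \<open>a\<close>,
  \<open>p\<close> forces \<open>y\<close>, \<open>y\<close> forces \<open>b\<close>,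
  \<open>a\<close> forces \<open>c\<close>, and \<open>c\<close> forces \<open>z\<close>. Eight
  vertices come from three.\<close>

lemma lone_triangle_diamond:
  assumes t: "lone_triangle a b c x y z" and Nx: "N x = {a, p, q}"
    and Np: "N p = {x, q, y}" and Nq: "N q = {x, p, y}"
    and out: "p \<notin> {a, b, c, x, y, z}" "q \<notin> {a, b, c, x, y, z}" "p \<noteq> q"
  shows "2 * forcing_number G + 1 \<le> card V"
proof -
  have N: "N a = {b, c, x}" "N b = {a, c, y}" "N c = {a, b, z}"
    and ne: "distinct [a, b, c, x, y, z]"
    using t by (simp_all add: lone_triangle_def)
  have "b \<in> N y" "p \<in> N y" "q \<in> N y"
    using N_sym[of y b] N_sym[of y p] N_sym[of y q] by (simp_all add: N Np Nq)
  then have Ny: "N y = {p, q, b}" using out by (intro N_eqI) auto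
  let ?S = "[x, p, q]"
  have init: "x \<in> forced G (set ?S)" "p \<in> forced G (set ?S)" "q \<in> forced G (set ?S)"
    by (simp_all add: forced.initial)
  have a: "a \<in> forced G (set ?S)"
    using forced_third[of x _ p q a] init Nx by (simp add: insert_commute)
  have y: "y \<in> forced G (set ?S)" using forced_third[OF init(2) Np] init by simp
  have b: "b \<in> forced G (set ?S)" using forced_third[OF y Ny] init by simp
  have c: "c \<in> forced G (set ?S)"
    using forced_third[of a _ b x c] a b init N(1) by (simp add: insert_commute)
  have z: "z \<in> forced G (set ?S)" using forced_third[OF c N(3)] a b by simp
  have "\<forall>s \<in> set ?S. \<exists>t \<in> forced G (set ?S). t \<in> N s"
    using a init by (auto simp: Nx Np Nq)
  moreover have "set ?S \<subseteq> V" using N_eq_verts[OF Nx] by simp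
  moreover have "distinct [x, p, q, y, a, b, c, z]" using ne out by auto
  ultimately show ?thesis
    using forcing_number_bound[of ?S "[x, p, q, y, a, b, c, z]" 1] init a b c y z by simp
qed

text \<open>Adding one vertex \<open>p\<close> of the triangle \<open>xpq\<close> to the start
  \<open>abc\<close> colours eight vertices. A ninth is the third neighbour \<open>p'\<close> of
  \<open>p\<close> or \<open>q'\<close> of \<open>q\<close>, unless both lie in {y, z}: if distinct,
  \<open>lone_triangle_split\<close> refutes this; if equal, \<open>lone_triangle_diamond\<close>
  applies.\<close>

lemma lone_triangle_nonadjacent:
  assumes t: "lone_triangle a b c x y z" and xy: "y \<notin> N x" "z \<notin> N x" "z \<notin> N y"
  shows "2 * forcing_number G + 1 \<le> card V"
proof -
  have N: "N a = {b, c, x}" "N b = {a, c, y}" "N c = {a, b, z}"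
    and ne: "distinct [a, b, c, x, y, z]"
    using t by (simp_all add: lone_triangle_def)
  have V: "set [a, b, c, x, y, z] \<subseteq> V" using lone_triangle_verts[OF t] .
  have adj: "a \<in> N x" "b \<in> N y" "c \<in> N z"
    using N_sym[of x a] N_sym[of y b] N_sym[of z c] N by simp_all
  have not_abc: "v \<notin> {a, b, c}" if "v \<in> N u" "u \<notin> {a, b, c, x, y, z}" for u v
    using N_sym[OF that(1)] that(2) by (auto simp: N)
  obtain p q where pq: "p \<in> N x" "q \<in> N x" "q \<in> N p"
    using triangle_at[of x] V by auto
  have x_abc: "v \<in> N x \<Longrightarrow> v \<noteq> b \<and> v \<noteq> c" for v
    using N_sym[of v x] ne by (auto simp: N)
  have nbr_a: "v = x" if "v \<in> N a" "v \<noteq> b" "v \<noteq> c" for v using that by (auto simp: N)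
  \<comment> \<open>If \<open>p\<close> were \<open>a\<close>, then \<open>q\<close> would be a
    common neighbour of \<open>a\<close> and \<open>x\<close>, hence \<open>b\<close> or
    \<open>c\<close>, neither of which is adjacent to \<open>x\<close>.\<close>
  have "p \<noteq> a" "q \<noteq> a"
    using nbr_a[of p] nbr_a[of q] pq x_abc N_irrefl[of x] N_sym[of q p] by metis+
  then have out: "p \<notin> {a, b, c, x, y, z}" "q \<notin> {a, b, c, x, y, z}"
    using pq x_abc xy N_irrefl[of x] by auto
  have "p \<noteq> q" using pq(3) N_irrefl by auto
  have Nx: "N x = {a, p, q}"
    using adj(1) pq(1,2) out \<open>p \<noteq> q\<close> by (intro N_eqI) auto
  have pqx: "x \<in> N p" "x \<in> N q" "p \<in> N q" using pq[THEN N_sym] by simp_all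
  obtain p' where Np: "N p = {x, q, p'}" and p': "p' \<noteq> x" "p' \<noteq> q"
    using third_neighbor[OF pqx(1) pq(3)] out by simp metis
  obtain q' where Nq: "N q = {x, p, q'}" and q': "q' \<noteq> x" "q' \<noteq> p"
    using third_neighbor[OF pqx(2,3)] out by simp metis
  let ?S = "[a, b, c, p]"
  have S: "set ?S \<subseteq> V" "?S \<noteq> []" using V N_verts[OF pq(1)] by simp_all
  have init: "a \<in> forced G (set ?S)" "b \<in> forced G (set ?S)" "c \<in> forced G (set ?S)"
    "p \<in> forced G (set ?S)" by (simp_all add: forced.initial)
  have F: "set [a, b, c, x, y, z] \<subseteq> forced G (set ?S)"
    using forced_lone_triangle[OF t init(1-3)] .
  have qF: "q \<in> forced G (set ?S)"
    using forced_third[of x _ a p q] F init Nx by simp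
  have nb: "\<forall>s \<in> set ?S. \<exists>t \<in> forced G (set ?S). t \<in> N s"
    using F init by (auto simp: N Np)
  have new: ?thesis if w: "w \<in> forced G (set ?S)" "w \<notin> {a, b, c, x, y, z, p, q}" for w
    using forcing_number_bound[OF S nb, of "[w, a, b, c, x, y, z, p, q]" 1] F qF init ne out w \<open>p \<noteq> q\<close>
    by auto
  have p'F: "p' \<in> forced G (set ?S)"
    using forced_third[OF init(4) Np] F qF by simp
  have q'F: "q' \<in> forced G (set ?S)"
    using forced_third[OF qF Nq] F init by simp
  have "p' \<noteq> p" "q' \<noteq> q" using N_irrefl[of p] N_irrefl[of q] by (auto simp: Np Nq)
  moreover have "p' \<notin> {a, b, c}" "q' \<notin> {a, b, c}"
    using not_abc[of p' p] not_abc[of q' q] out by (simp_all add: Np Nq)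
  ultimately consider "p' \<notin> {a, b, c, x, y, z, p, q}" | "q' \<notin> {a, b, c, x, y, z, p, q}"
    | "p' \<in> {y, z}" "q' \<in> {y, z}"
    using p' q' by auto
  then show ?thesis
  proof cases
    case 3
    then consider "p' = y" "q' = z" | "p' = z" "q' = y" | "p' = y" "q' = y" | "p' = z" "q' = z"
      by auto
    then show ?thesis
    proof cases
      case 1
      then show ?thesis using lone_triangle_split[OF t xy(1)] Np Nq out by blast
    next
      case 2
      then show ?thesis using lone_triangle_split[OF t xy(1)] Np Nq out by blast
    next
      case 3
      then show ?thesis using lone_triangle_diamond[OF t Nx] Np Nq out \<open>p \<noteq> q\<close> by blast
    next
      case 4
      have "p \<notin> {a, c, b, x, z, y}" "q \<notin> {a, c, b, x, z, y}" using out by auto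
      with 4 show ?thesis
        using lone_triangle_diamond[OF lone_triangle_swap23[OF t] Nx] Np Nq \<open>p \<noteq> q\<close> by blast
    qed
  qed (use new p'F q'F in blast)+
qed

lemma lone_triangle_cases:
  assumes t: "lone_triangle a b c x y z"
  shows "2 * forcing_number G + 1 \<le> card V \<or> digraph_iso G prism"
proof -
  consider "y \<in> N x" | "z \<in> N x" | "z \<in> N y" | "y \<notin> N x" "z \<notin> N x" "z \<notin> N y"
    by blast
  then show ?thesis
  proof cases
    case 1
    then show ?thesis using lone_triangle_adjacent[OF t] by blast
  next
    case 2
    then show ?thesis using lone_triangle_adjacent[OF lone_triangle_swap23[OF t]] by blast
  next
    case 3
    then show ?thesis
      using lone_triangle_adjacent[OF lone_triangle_swap23[OF lone_triangle_swap12[OF t]]] by blast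
  next
    case 4
    then show ?thesis using lone_triangle_nonadjacent[OF t] by blast
  qed
qed

section \<open>Graphs in which every triangle lies in a diamond\<close>

lemma ends_diamond_exists:
  assumes no: "\<And>a b c x y z. \<not> lone_triangle a b c x y z"
  obtains a b c d x y where "ends_diamond a b c d x y"
proof -
  obtain u where "u \<in> V" using connected by (auto simp: connected_conv)
  then obtain p q where "p \<in> N u" "q \<in> N u" "q \<in> N p" by (rule triangle_at)
  then show thesis
  proof (cases rule: triangle_or_diamond)
    case (1 x y z)
    with no show ?thesis by blast
  next
    case (2 e)
    then show ?thesis
      using ends_diamond_at[of u q e p] that by (simp add: insert_commute) metis
  next
    case (3 e)
    then show ?thesis
      using ends_diamond_at[of u p e q] that by (simp add: insert_commute) metis
  next
    case (4 e)
    then show ?thesis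
      using ends_diamond_at[of p u e q] that by (simp add: insert_commute) metis
  qed
qed

text \<open>The edge \<open>ax\<close> lies in no triangle, so the triangle at \<open>x\<close> uses
  the other neighbours \<open>p\<close>, \<open>q\<close>. By \<open>no\<close>, two of its vertices
  share a further neighbour; were \<open>x\<close> one of them, this would be \<open>a\<close>,
  giving a triangle on \<open>ax\<close>. Hence \<open>p\<close> and \<open>q\<close> are the middle
  vertices and \<open>x\<close> is an end.\<close>

lemma next_ends_diamond:
  assumes no: "\<And>a b c x y z. \<not> lone_triangle a b c x y z" and D: "ends_diamond a b c d x y"
  obtains e p q z where "ends_diamond x e p q a z"
proof -
  have N: "N a = {c, d, x}" "N b = {c, d, y}" "N c = {a, b, d}" "N d = {a, b, c}"
    and ne: "distinct [a, b, c, d, x, y]"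
    using D by (simp_all add: ends_diamond_def)
  have ax: "a \<in> N x" using N_sym[of x a] by (simp add: N)
  have off_a: "v \<notin> N a" if "v \<in> N x" for v
    using N_sym[OF that] that N_irrefl[of x] ne by (auto simp: N)
  obtain p q where pq: "p \<in> N x" "q \<in> N x" "q \<in> N p"
    using triangle_at N_verts(1)[OF ax] by metis
  have "p \<noteq> a" "q \<noteq> a" using off_a[of p] off_a[of q] pq N_sym[of q p] by auto
  then have Nx: "N x = {p, q, a}"
    using pq ax N_irrefl[of p] by (intro N_eqI) auto
  have a_off: "a \<notin> N p" "a \<notin> N q" using off_a[OF pq(1)] off_a[OF pq(2)] N_sym by blast+
  from pq show thesis
  proof (cases rule: triangle_or_diamond)
    case (1 x y z)
    with no show ?thesis by blast
  next
    case (2 e)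
    have "a \<in> {p, q, e}" using ax by (simp add: 2)
    then have "a \<in> N p" using \<open>p \<noteq> a\<close> by (auto simp: 2)
    with a_off show ?thesis by blast
  next
    case (3 e)
    have "a \<in> {p, q, e}" using ax by (simp add: 3)
    then have "a \<in> N q" using \<open>q \<noteq> a\<close> by (auto simp: 3)
    with a_off show ?thesis by blast
  next
    case (4 e)
    then obtain x' z where D': "ends_diamond x e p q x' z"
      using ends_diamond_at[of p x e q] by (simp add: insert_commute) metis
    then have "N x = {p, q, x'}" by (simp add: ends_diamond_def)
    then have "x' = a" using ax \<open>p \<noteq> a\<close> \<open>q \<noteq> a\<close> by auto
    with D' that show ?thesis by blast
  qed
qed

lemma ends_diamond_bound:
  assumes D: "ends_diamond a b c d x y"
  shows "2 * forcing_number G \<le> card V"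
proof -
  have N: "N a = {c, d, x}" "N c = {a, b, d}" "N d = {a, b, c}"
    and ne: "distinct [a, b, c, d, x, y]"
    using D by (simp_all add: ends_diamond_def)
  let ?S = "[a, c, d]"
  have init: "a \<in> forced G (set ?S)" "c \<in> forced G (set ?S)" "d \<in> forced G (set ?S)"
    by (simp_all add: forced.initial)
  have "\<forall>s \<in> set ?S. \<exists>t \<in> forced G (set ?S). t \<in> N s"
    using init by (auto simp: N)
  moreover have "set ?S \<subseteq> V" using N_eq_verts[OF N(1)] by simp
  ultimately show ?thesis
    using forcing_number_bound[of ?S "[a, b, c, d, x, y]" 0] forced_ends_diamond[OF D init] ne
    by simp
qed

text \<open>The diamond entered from \<open>a\<close> has ends \<open>x\<close> and
  \<open>e\<close>. If \<open>e = y\<close>, it leads back to \<open>b\<close> and the graph is the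
  necklace. Otherwise \<open>p\<close> joins the start \<open>acd\<close>: \<open>x\<close> forces
  \<open>q\<close>, the second diamond fills up, and nine vertices come from four.\<close>

lemma ends_diamond_cases:
  assumes no: "\<And>a b c x y z. \<not> lone_triangle a b c x y z" and D: "ends_diamond a b c d x y"
  shows "2 * forcing_number G + 1 \<le> card V \<or> digraph_iso G diamond_necklace_2"
proof -
  obtain e p q z where E: "ends_diamond x e p q a z"
    using next_ends_diamond[OF no D] .
  have N: "N a = {c, d, x}" "N b = {c, d, y}" "N c = {a, b, d}" "N d = {a, b, c}"
    and ne: "distinct [a, b, c, d, x, y]"
    using D by (simp_all add: ends_diamond_def)
  have M: "N x = {p, q, a}" "N e = {p, q, z}" "N p = {x, e, q}" "N q = {x, e, p}"
    and me: "distinct [x, e, p, q, a, z]"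
    using E by (simp_all add: ends_diamond_def)
  have "x \<notin> N b" "x \<notin> N c" "x \<notin> N d" using ne by (auto simp: N)
  moreover have "x \<in> N p" "x \<in> N q" by (simp_all add: M)
  ultimately have out: "p \<notin> {a, b, c, d}" "q \<notin> {a, b, c, d}" using me by auto
  have "p \<in> N e" "q \<in> N e" by (simp_all add: M)
  \<comment> \<open>All neighbours of \<open>c\<close> and \<open>d\<close> lie in the first
    diamond, and \<open>e = b\<close> would make both \<open>p\<close> and \<open>q\<close> equal to
    \<open>y\<close>.\<close>
  then have eout: "e \<notin> {a, b, c, d}" using out me by (auto simp: N)
  have b_y: "b \<in> N y" using N_sym[of y b] by (simp add: N)
  have "b \<notin> N p" "b \<notin> N q" using ne out eout by (auto simp: M)
  then have pqy: "p \<noteq> y" "q \<noteq> y" using b_y by auto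
  show ?thesis
  proof (cases "e = y")
    case True
    then have "b = z" using b_y out by (auto simp: M(2) simp flip: True)
    moreover have "distinct [a, b, c, d, x, y, p, q]" using ne me out pqy by auto
    ultimately show ?thesis using necklace_iso D E True by blast
  next
    case False
    let ?S = "[a, c, d, p]"
    have init: "a \<in> forced G (set ?S)" "c \<in> forced G (set ?S)" "d \<in> forced G (set ?S)"
      "p \<in> forced G (set ?S)"
      by (simp_all add: forced.initial)
    have F: "set [a, b, c, d, x, y] \<subseteq> forced G (set ?S)"
      using forced_ends_diamond[OF D init(1-3)] .
    have "q \<in> forced G (set ?S)"
      using forced_third[of x _ p a q] F init M(1) by (simp add: insert_commute)
    then have F': "set [x, e, p, q, a, z] \<subseteq> forced G (set ?S)"
      using F init(4) by (intro forced_ends_diamond[OF E]) simp_all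
    have "\<forall>s \<in> set ?S. \<exists>t \<in> forced G (set ?S). t \<in> N s"
      using F by (auto simp: N M)
    moreover have "set ?S \<subseteq> V" using N_eq_verts[OF N(1)] N_eq_verts[OF M(1)] by simp
    \<comment> \<open>\<open>z\<close> is not counted, as it has not been shown to differ from
      \<open>y\<close>.\<close>
    moreover have "distinct [a, b, c, d, x, y, p, q, e]"
      using ne me out eout pqy False by auto
    ultimately show ?thesis
      using forcing_number_bound[of ?S "[a, b, c, d, x, y, p, q, e]" 1] F F' by simp
  qed
qed

lemma forcing_number_cases:
  "2 * forcing_number G \<le> card V \<and>
    (2 * forcing_number G + 1 \<le> card V \<or>
      digraph_iso G diamond_necklace_2 \<or> digraph_iso G prism)"
proof (cases "\<exists>a b c x y z. lone_triangle a b c x y z")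
  case True
  then show ?thesis using lone_triangle_bound(1) lone_triangle_cases by blast
next
  case False
  then have no: "\<not> lone_triangle a b c x y z" for a b c x y z by blast
  obtain a b c d x y where "ends_diamond a b c d x y"
    using ends_diamond_exists[OF no] .
  then show ?thesis using ends_diamond_bound ends_diamond_cases[OF no] by blast
qed

end

theorem theorem3:
  fixes G :: "'a pair_pre_digraph" and n :: nat
  assumes "pair_graph G"
    and "\<not> complete_digraph 4 G"
    and "Digraph_Component.connected G"
    and "claw_free G"
    and "cubic G"
    and "card (pverts G) = n"
  shows "real (forcing_number G) \<le> 1 / 2 * real n \<and>
    (real (forcing_number G) = 1 / 2 * real n \<longleftrightarrow>
      digraph_iso G diamond_necklace_2 \<or> digraph_iso G prism)"
proof -
  interpret pair_graph G by fact
  interpret claw_free_cubic_graph G by unfold_locales fact+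
  have wf: "pair_wf_digraph G" by unfold_locales
  \<comment> \<open>For the two exceptional graphs the lower bound meets the upper bound
    \<open>n\<close>; for all others \<open>forcing_number_cases\<close> gives strict
    inequality.\<close>
  have "8 \<le> 2 * forcing_number G \<and> n = 8" if iso: "digraph_iso G diamond_necklace_2"
  proof -
    obtain f where "inj_on f (pverts G)" "f ` pverts G = pverts diamond_necklace_2"
      using digraph_isoE[OF iso] by metis
    then have "n = card (pverts diamond_necklace_2)" using assms(6) card_image by metis
    then show ?thesis
      using forcing_number_le_iso[OF wf iso] forcing_number_necklace by (simp add: pverts_necklace)
  qed
  moreover have "6 \<le> 2 * forcing_number G \<and> n = 6" if iso: "digraph_iso G prism"
  proof -
    obtain f where "inj_on f (pverts G)" "f ` pverts G = pverts prism"
      using digraph_isoE[OF iso] by metis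
    then have "n = card (pverts prism)" using assms(6) card_image by metis
    then show ?thesis
      using forcing_number_le_iso[OF wf iso] forcing_number_prism by (simp add: pverts_prism)
  qed
  ultimately have "2 * forcing_number G \<le> n \<and>
    (2 * forcing_number G = n \<longleftrightarrow> digraph_iso G diamond_necklace_2 \<or> digraph_iso G prism)"
    using forcing_number_cases assms(6) by linarith
  then show ?thesis by (simp add: field_simps) linarith
qed

end
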